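(* Let $\Gamma$ be a locally finite graph with a fixed base vertex $v_0$. For each $n\in\mathbb{Z}_{\ge 0}$, let $t_n$ be the number of loops of length $n$ in $\Gamma$ which start and end at $v_0$. Then there exists a probability measure $\mu$ on $\mathbb{R}$ such that for each $n\in\mathbb{Z}_{\ge 0}$ the $n$th moment of $\mu$ is given by $$\int_{-\infty}^{\infty} x^n\,d\mu = t_n .$$ In other words, $t_0,t_1,t_2,\ldots$ is a Hamburger moment sequence.
   Context: Graphs are undirected. A graph is locally finite if every vertex has finite degree. A loop of length $n$ which starts and ends at $v_0$ means a closed walk of length $n$ from $v_0$ to $v_0$ (vertices and edges may be repeated); in particular $t_0=1$. A sequence $a_0,a_1,\ldots$ of real numbers is a Hamburger moment sequence if there is a positive measure $\mu$ on $(-\infty,\infty)$ with $a_n=\int x^n\,d\mu(x)$ for all $n\ge 0$. *)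

theory Defs
  imports "HOL-Probability.Probability"
begin

text \<open>
  An undirected graph with vertex set \<open>V\<close> and edge set \<open>E\<close>, both possibly infinite. Every edge is
  incident to an unordered pair of vertices; parallel edges, and edges joining a vertex to
  itself (\<open>ends e = {v}\<close>), are permitted. A simple graph is the case where \<open>E\<close> is a set of
  two-element subsets of \<open>V\<close> and \<open>ends\<close> is the identity on \<open>E\<close>.
\<close>

locale undirected_graph =
  fixes V :: "'v set" and E :: "'e set" and ends :: "'e \<Rightarrow> 'v set"
  assumes ends_vertices: "e \<in> E \<Longrightarrow> \<exists>u\<in>V. \<exists>v\<in>V. ends e = {u, v}"

text \<open>Finiteness of the degree does not depend on how often an edge with equal ends is counted.\<close>

locale locally_finite_graph = undirected_graph +
  assumes finite_degree: "v \<in> V \<Longrightarrow> finite {e \<in> E. v \<in> ends e}"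

text \<open>
  A closed walk of length \<open>n\<close> from \<open>v\<^sub>0\<close> to \<open>v\<^sub>0\<close> is an alternating sequence of \<open>n + 1\<close> vertices \<open>vs\<close>
  and \<open>n\<close> edges \<open>es\<close>, the edge \<open>es ! i\<close> joining \<open>vs ! i\<close> to \<open>vs ! Suc i\<close>. Traversals of parallel
  edges are thus counted separately, and an edge with equal ends is traversed in one way only.
\<close>

definition closed_walks ::
  "'v set \<Rightarrow> 'e set \<Rightarrow> ('e \<Rightarrow> 'v set) \<Rightarrow> 'v \<Rightarrow> nat \<Rightarrow> ('v list \<times> 'e list) set" where
  "closed_walks V E ends v0 n =
     {(vs, es). length vs = Suc n \<and> length es = n \<and> set vs \<subseteq> V \<and> set es \<subseteq> E \<and>
        vs ! 0 = v0 \<and> vs ! n = v0 \<and> (\<forall>i<n. ends (es ! i) = {vs ! i, vs ! Suc i})}"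

definition hamburger_moment_sequence :: "(nat \<Rightarrow> real) \<Rightarrow> bool" where
  "hamburger_moment_sequence a \<longleftrightarrow>
     (\<exists>\<mu> :: real measure. sets \<mu> = sets borel \<and>
        (\<forall>n. has_bochner_integral \<mu> (\<lambda>x. x ^ n) (a n)))"

end

theory Submission
  imports Defs "HOL-Computational_Algebra.Fundamental_Theorem_Algebra"
begin

text \<open>
  Let \<open>w\<^sub>i v\<close> be the number of walks of length \<open>i\<close> from \<open>v0\<close> to \<open>v\<close>. Splitting a closed walk of length
  \<open>i + j\<close> after \<open>i\<close> steps and reversing its second half gives \<open>t (i + j) = (\<Sum>v. w\<^sub>i v * w\<^sub>j v)\<close>, so
  \<open>(\<Sum>i j. c i * c j * t (i + j))\<close> is a sum of squares. Hence the functional \<open>L\<close> on real polynomials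
  with \<open>L (x ^ n) = t n\<close> is nonnegative on squares. The zeros of an orthogonal polynomial
  of \<open>L\<close> are real and simple, and the Gauss quadrature at these zeros is a finitely
  supported probability measure with the prescribed moments of all orders below \<open>n\<close>. As the second
  moments agree, these measures are tight; by Helly's theorem a subsequence converges weakly, and
  the bounds on the even moments carry the moments over to the limit.
\<close>

section \<open>Gauss quadrature for positive functionals\<close>

locale positive_functional =
  fixes L :: "real poly \<Rightarrow> real"
  assumes add: "L (p + q) = L p + L q"
    and smult: "L (Polynomial.smult c p) = c * L p"
    and square_nonneg: "L (p * p) \<ge> 0"
begin

lemma zero [simp]: "L 0 = 0"
  using smult[of 0 0] by simp

lemma diff: "L (p - q) = L p - L q"
  using add[of "p - q" q] by simp

lemma sum: "L (\<Sum>x\<in>A. f x) = (\<Sum>x\<in>A. L (f x))"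
  by (induction A rule: infinite_finite_induct) (auto simp: add)

text \<open>The degenerate case of Cauchy-Schwarz: if \<open>L (p * p) = 0\<close>, then
  \<open>L\<close> of the square of \<open>q + t p\<close> is affine in \<open>t\<close> with slope
  \<open>2 * L (p * q)\<close>. It stays nonnegative for all real \<open>t\<close> only if the slope
  vanishes.\<close>

lemma orthogonal_if_null:
  assumes "L (p * p) = 0"
  shows "L (p * q) = 0"
proof (rule ccontr)
  assume nz: "L (p * q) \<noteq> 0"
  \<comment> \<open>Solves \<open>L (q * q) + 2 * t * L (p * q) = -1\<close>.\<close>
  define t where "t = - (L (q * q) + 1) / (2 * L (p * q))"
  have "(q + Polynomial.smult t p) * (q + Polynomial.smult t p)
      = q * q + Polynomial.smult (2 * t) (p * q) + Polynomial.smult (t * t) (p * p)"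
    using smult_add_left[of t t "p * q"]
    by (simp add: distrib_left distrib_right mult.commute[of q p] add.assoc smult_add_right)
  hence "0 \<le> L (q * q + Polynomial.smult (2 * t) (p * q) + Polynomial.smult (t * t) (p * p))"
    using square_nonneg[of "q + Polynomial.smult t p"] by simp
  also have "\<dots> = L (q * q) + 2 * t * L (p * q)"
    using assms by (simp add: add smult)
  also have "\<dots> = -1"
    using nz by (simp add: t_def field_simps)
  finally show False by simp
qed

text \<open>Gram-Schmidt, one degree at a time; positivity below degree \<open>n\<close> allows
  division by \<open>L (u * u)\<close>. Since the zero polynomial has \<open>degree\<close> 0, the
  disjuncts \<open>g = 0\<close> and \<open>q = 0\<close> make the case \<open>n = 0\<close> that of
  the zero space.\<close>

lemma orthogonal_projection:
  assumes "\<And>r. r \<noteq> 0 \<Longrightarrow> degree r < n \<Longrightarrow> L (r * r) > 0"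
  shows "\<exists>g. (g = 0 \<or> degree g < n) \<and> (\<forall>q. q = 0 \<or> degree q < n \<longrightarrow> L ((f - g) * q) = 0)"
  using assms
proof (induction n arbitrary: f)
  case 0
  show ?case by (intro exI[of _ 0]) auto
next
  case (Suc n)
  have pd: "L (r * r) > 0" if "r \<noteq> 0" "degree r < n" for r
    using Suc.prems[of r] that by simp
  obtain g where g: "g = 0 \<or> degree g < n" "\<And>q. q = 0 \<or> degree q < n \<Longrightarrow> L ((f - g) * q) = 0"
    using Suc.IH[of f] pd by blast
  obtain h where h: "h = 0 \<or> degree h < n"
      "\<And>q. q = 0 \<or> degree q < n \<Longrightarrow> L ((monom 1 n - h) * q) = 0"
    using Suc.IH[of "monom 1 n"] pd by blast
  \<comment> \<open>The monic orthogonal polynomial of degree \<open>n\<close>: the one direction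
    that the induction step adds.\<close>
  define u where "u = monom 1 n - h"
  have coeff_h: "coeff h n = 0" using h(1) by (auto simp: coeff_eq_0)
  have "coeff u n = 1" by (simp add: u_def coeff_h)
  hence u0: "u \<noteq> 0" by auto
  have deg_u: "degree u \<le> n"
    using h(1) by (auto simp: u_def intro!: degree_diff_le degree_monom_le)
  have Lu: "L (u * u) > 0" using Suc.prems[of u] u0 deg_u by simp
  define c where "c = L ((f - g) * u) / L (u * u)"
  define g' where "g' = g + Polynomial.smult c u"
  have split: "L ((f - g') * q) = L ((f - g) * q) - c * L (u * q)" for q
  proof -
    have "(f - g') * q = (f - g) * q - Polynomial.smult c (u * q)"
      by (simp add: g'_def algebra_simps)
    thus ?thesis by (simp add: diff smult)
  qed
  have "L ((f - g') * q) = 0" if "q = 0 \<or> degree q < Suc n" for q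
  proof -
    \<comment> \<open>Removing the leading term by a multiple of the monic \<open>u\<close> brings
      \<open>q\<close> within reach of the induction hypothesis.\<close>
    define q' where "q' = q - Polynomial.smult (coeff q n) u"
    have "degree q' \<le> n"
      unfolding q'_def using that deg_u
      by (intro degree_diff_le) (auto intro: order.trans[OF degree_smult_le])
    moreover have "coeff q' n = 0" by (simp add: q'_def \<open>coeff u n = 1\<close>)
    ultimately have q': "q' = 0 \<or> degree q' < n"
      by (metis leading_coeff_0_iff le_neq_implies_less)
    have "(f - g') * q = (f - g') * q' + Polynomial.smult (coeff q n) ((f - g') * u)"
      by (simp add: q'_def algebra_simps)
    moreover have "L ((f - g') * q') = 0"
      using g(2)[OF q'] h(2)[OF q'] by (simp add: split u_def)
    moreover have "L ((f - g') * u) = 0"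
      using Lu by (simp add: split c_def)
    ultimately show ?thesis by (simp add: add smult)
  qed
  moreover have "degree g' < Suc n"
    using g(1) deg_u unfolding g'_def
    by (auto simp: less_Suc_eq_le intro!: degree_add_le order.trans[OF degree_smult_le])
  ultimately show ?case by blast
qed

text \<open>
  If \<open>L\<close> is degenerate, a null vector of minimal degree is orthogonal to everything; its degree may
  be smaller than \<open>n\<close>.
\<close>

lemma ex_orthogonal_poly:
  "\<exists>P. P \<noteq> 0 \<and> degree P \<le> n \<and> (\<forall>q. degree q < n \<longrightarrow> L (P * q) = 0) \<and>
       (\<forall>r. r \<noteq> 0 \<longrightarrow> degree r < degree P \<longrightarrow> L (r * r) > 0)"
proof (cases "\<exists>r. r \<noteq> 0 \<and> degree r < n \<and> L (r * r) = 0")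
  case True
  then obtain P where P: "P \<noteq> 0 \<and> degree P < n \<and> L (P * P) = 0"
      and min: "\<And>r. r \<noteq> 0 \<and> degree r < n \<and> L (r * r) = 0 \<Longrightarrow> degree P \<le> degree r"
    using ex_has_least_nat[of "\<lambda>r. r \<noteq> 0 \<and> degree r < n \<and> L (r * r) = 0" _ degree] by blast
  have "L (r * r) > 0" if "r \<noteq> 0" "degree r < degree P" for r
    using min[of r] that P square_nonneg[of r] by (force simp: less_le)
  thus ?thesis using P orthogonal_if_null by (intro exI[of _ P]) auto
next
  case False
  hence pd: "L (r * r) > 0" if "r \<noteq> 0" "degree r < n" for r
    using that square_nonneg[of r] by (force simp: less_le)
  obtain g where g: "g = 0 \<or> degree g < n"
      "\<And>q. q = 0 \<or> degree q < n \<Longrightarrow> L ((monom 1 n - g) * q) = 0"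
    using orthogonal_projection[of n "monom 1 n"] pd by blast
  \<comment> \<open>In the nondegenerate case \<open>P\<close> is the monic orthogonal polynomial of
    degree exactly \<open>n\<close>.\<close>
  define P where "P = monom 1 n - g"
  have "coeff P n = 1" using g(1) by (auto simp: P_def coeff_eq_0)
  moreover have "degree P \<le> n"
    using g(1) by (auto simp: P_def intro!: degree_diff_le degree_monom_le)
  ultimately have "P \<noteq> 0" "degree P \<le> n" by auto
  thus ?thesis using g(2) pd unfolding P_def[symmetric] by (intro exI[of _ P]) auto
qed

end

section \<open>Factors of real polynomials\<close>

lemma prod_roots_dvd:
  fixes p :: "'a :: field poly"
  assumes "finite A" "\<And>x. x \<in> A \<Longrightarrow> poly p x = 0"
  shows "(\<Prod>x\<in>A. [:-x, 1:]) dvd p"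
  using assms
proof (induction A rule: finite_induct)
  case (insert a A)
  then obtain r where r: "p = (\<Prod>x\<in>A. [:-x, 1:]) * r" by (auto elim: dvdE)
  have "poly (\<Prod>x\<in>A. [:-x, 1:]) a \<noteq> 0"
    using insert.hyps by (auto simp: poly_prod)
  hence "poly r a = 0" using insert.prems[of a] r by simp
  then obtain s where s: "r = [:-a, 1:] * s" by (auto simp only: poly_eq_0_iff_dvd elim: dvdE)
  have "p = (\<Prod>x\<in>insert a A. [:-x, 1:]) * s"
    unfolding r s prod.insert[OF insert.hyps] by (simp only: mult_ac)
  thus ?case by (rule dvdI)
qed auto

lemma map_poly_of_real_add:
  "map_poly of_real (p + q) = (map_poly of_real p + map_poly of_real q :: 'a :: real_algebra_1 poly)"
  by (intro poly_eqI) (simp add: coeff_map_poly)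

lemma map_poly_of_real_mult:
  "map_poly of_real (p * q) =
     (map_poly of_real p * map_poly of_real q :: 'a :: {real_algebra_1,comm_semiring_0} poly)"
  by (intro poly_eqI) (simp add: coeff_map_poly coeff_mult)

lemma degree_le1E:
  assumes "degree p \<le> 1"
  obtains c d where "p = [:c, d:]"
proof -
  have "p = [:coeff p 0, coeff p 1:]"
    using assms by (intro poly_eqI) (auto simp: coeff_pCons coeff_eq_0 split: nat.splits)
  thus ?thesis by (rule that)
qed

text \<open>Take a complex zero \<open>z = a + b i\<close>. If \<open>b\<close> is nonzero, division
  by \<open>(x - a)^2 + b^2\<close> leaves a remainder of degree at most 1 with the nonreal zero
  \<open>z\<close>, hence 0. The quadratic factor is kept as a sum of squares, the form in which
  positivity of \<open>L\<close> applies.\<close>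

lemma real_poly_factor:
  fixes p :: "real poly"
  assumes "degree p > 0"
  obtains a where "poly p a = 0"
    | a b q where "b \<noteq> 0" "p = ([:-a, 1:] * [:-a, 1:] + [:b * b:]) * q"
proof -
  have "\<exists>z. poly (map_poly complex_of_real p) z = 0"
    using assms by (intro fundamental_theorem_of_algebra) (simp add: constant_degree degree_map_poly)
  then obtain z where z: "poly (map_poly complex_of_real p) z = 0" by blast
  define a b where "a = Re z" and "b = Im z"
  show ?thesis
  proof (cases "b = 0")
    case True
    hence "z = complex_of_real a" by (simp add: a_def b_def complex_eq_iff)
    hence "complex_of_real (poly p a) = 0"
      using z by (simp add: poly_altdef coeff_map_poly degree_map_poly)
    hence "poly p a = 0" by simp
    thus ?thesis using that(1) by blast
  next
    case False
    define m where "m = [:-a, 1:] * [:-a, 1:] + [:b * b:]"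
    have m: "m = [:a * a + b * b, - 2 * a, 1:]" by (simp add: m_def)
    have dm: "degree m = 2" by (simp add: m)
    define r where "r = p mod m"
    have "r = 0 \<or> degree r < degree m"
      unfolding r_def using dm by (intro degree_mod_less) auto
    hence "degree r \<le> 1" using dm by auto
    then obtain c d where cd: "r = [:c, d:]" by (rule degree_le1E)
    have zz: "z * z = of_real (2 * a) * z - of_real (a * a + b * b)"
      by (simp add: a_def b_def complex_eq_iff)
    have "poly (map_poly complex_of_real m) z = 0"
      using zz by (simp add: m map_poly_pCons algebra_simps)
    moreover have "map_poly complex_of_real (m * (p div m) + r) = map_poly complex_of_real m *
        map_poly complex_of_real (p div m) + map_poly complex_of_real r"
      by (simp only: map_poly_of_real_add map_poly_of_real_mult)
    hence "map_poly complex_of_real p = map_poly complex_of_real m *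
        map_poly complex_of_real (p div m) + map_poly complex_of_real r"
      by (simp add: r_def)
    ultimately have "poly (map_poly complex_of_real r) z = 0" using z by simp
    \<comment> \<open>Real and imaginary part of \<open>c + d * z = 0\<close>; as \<open>b\<close>
      is nonzero, first \<open>d\<close> and then \<open>c\<close> vanish.\<close>
    hence "c + a * d = 0" "b * d = 0"
      by (auto simp: cd map_poly_pCons complex_eq_iff a_def b_def mult.commute)
    hence "r = 0" using False by (simp add: cd)
    hence "p = m * (p div m)" using mult_div_mod_eq[of m p] by (simp add: r_def)
    thus ?thesis using that(2) False unfolding m_def by blast
  qed
qed

section \<open>Zeros of orthogonal polynomials and the quadrature formula\<close>

context positive_functional
begin

text \<open>The case \<open>b = 0\<close> excludes multiple real zeros, \<open>b \<noteq> 0\<close> excludes non-real ones.\<close>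

lemma no_nonneg_quadratic_factor:
  assumes P: "P \<noteq> 0" "degree P \<le> n" "\<And>q. degree q < n \<Longrightarrow> L (P * q) = 0"
    and pd: "\<And>r. r \<noteq> 0 \<Longrightarrow> degree r < degree P \<Longrightarrow> L (r * r) > 0"
  shows "P \<noteq> ([:-a, 1:] * [:-a, 1:] + [:b * b:]) * q"
proof
  assume eq: "P = ([:-a, 1:] * [:-a, 1:] + [:b * b:]) * q"
  have q: "q \<noteq> 0" using P(1) eq by auto
  have deg: "degree P = 2 + degree q"
    using q unfolding eq by (subst degree_mult_eq) auto
  define u where "u = [:-a, 1:] * q"
  have u: "u \<noteq> 0" "degree u < degree P"
    using q by (auto simp: u_def degree_mult_eq deg simp del: mult_pCons_left)
  \<comment> \<open>Testing \<open>P\<close> against its own cofactor gives a sum of squares, while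
    \<open>degree q < n\<close> makes it orthogonal to \<open>P\<close>.\<close>
  have "P * q = u * u + Polynomial.smult (b * b) (q * q)"
  proof -
    have "(v * v + [:b * b:]) * q * q = v * q * (v * q) + Polynomial.smult (b * b) (q * q)" for v
      by (simp add: distrib_left distrib_right mult_ac)
    thus ?thesis unfolding eq u_def by blast
  qed
  moreover have "L (P * q) = 0" using P(2) deg by (intro P(3)) simp
  ultimately have "L (u * u) + b * b * L (q * q) = 0" by (simp add: add smult)
  moreover have "b * b * L (q * q) \<ge> 0" using square_nonneg[of q] by simp
  ultimately show False using pd[OF u] by linarith
qed

text \<open>The linear factors of the distinct real zeros divide \<open>P\<close>. A nonconstant
  cofactor would contribute either a repeated real zero or a nonreal pair, and both are
  excluded.\<close>

lemma real_rooted: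
  assumes P: "P \<noteq> 0" "degree P \<le> n" "\<And>q. degree q < n \<Longrightarrow> L (P * q) = 0"
    and pd: "\<And>r. r \<noteq> 0 \<Longrightarrow> degree r < degree P \<Longrightarrow> L (r * r) > 0"
  obtains c where "P = Polynomial.smult c (\<Prod>x | poly P x = 0. [:-x, 1:])"
proof -
  define X where "X = {x. poly P x = 0}"
  have fin: "finite X" using P(1) unfolding X_def by (rule poly_roots_finite)
  have "(\<Prod>x\<in>X. [:-x, 1:]) dvd P"
    using fin by (rule prod_roots_dvd) (simp add: X_def)
  then obtain R where R: "P = (\<Prod>x\<in>X. [:-x, 1:]) * R" by (rule dvdE)
  note no_factor = no_nonneg_quadratic_factor[OF P pd]
  have "degree R = 0"
  proof (rule ccontr)
    assume "degree R \<noteq> 0"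
    hence "degree R > 0" by simp
    thus False
    proof (cases rule: real_poly_factor)
      case (1 a)
      hence "poly P a = 0" by (simp add: R)
      hence "a \<in> X" by (simp add: X_def)
      hence rem: "(\<Prod>x\<in>X. [:-x, 1:]) = [:-a, 1:] * (\<Prod>x\<in>X - {a}. [:-x, 1:])"
        by (rule prod.remove[OF fin])
      obtain s where s: "R = [:-a, 1:] * s"
        using 1 by (auto simp only: poly_eq_0_iff_dvd elim: dvdE)
      have "u * Q * (u * s) = (u * u + [:0 * 0:]) * (Q * s)" for u Q :: "real poly"
        by (simp add: mult_ac)
      hence "P = ([:-a, 1:] * [:-a, 1:] + [:0 * 0:]) * ((\<Prod>x\<in>X - {a}. [:-x, 1:]) * s)"
        unfolding R rem s by blast
      with no_factor show False by (rule notE)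
    next
      case (2 a b q)
      hence "P = ([:-a, 1:] * [:-a, 1:] + [:b * b:]) * ((\<Prod>x\<in>X. [:-x, 1:]) * q)"
        by (simp only: R mult_ac)
      with no_factor show False by (rule notE)
    qed
  qed
  then obtain c where "R = [:c:]" by (rule degree_eq_zeroE)
  hence "P = Polynomial.smult c (\<Prod>x\<in>X. [:-x, 1:])" using R by simp
  thus ?thesis unfolding X_def by (rule that)
qed

text \<open>The nodes are the zeros of the orthogonal polynomial, the weights the values of
  \<open>L\<close> on the Lagrange basis. The formula is exact even below degree
  \<open>n + card X\<close>, which is what makes the weights nonnegative.\<close>

lemma quadrature:
  "\<exists>X w. finite X \<and> (\<forall>x\<in>X. w x \<ge> 0) \<and> (\<forall>p. degree p < n \<longrightarrow> L p = (\<Sum>x\<in>X. w x * poly p x))"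
proof -
  obtain P where P: "P \<noteq> 0" "degree P \<le> n" "\<And>q. degree q < n \<Longrightarrow> L (P * q) = 0"
      and pd: "\<And>r. r \<noteq> 0 \<Longrightarrow> degree r < degree P \<Longrightarrow> L (r * r) > 0"
    using ex_orthogonal_poly[of n] by blast
  define X where "X = {x. poly P x = 0}"
  have fin: "finite X" using P(1) unfolding X_def by (rule poly_roots_finite)
  obtain c where c: "P = Polynomial.smult c (\<Prod>x\<in>X. [:-x, 1:])"
    using real_rooted[OF P pd] unfolding X_def .
  have c0: "c \<noteq> 0" using c P(1) by auto
  have deg_prod: "degree (\<Prod>x\<in>A. [:-x, 1:]) = card A" for A :: "real set"
    by (subst degree_prod_eq_sum_degree) auto
  have deg: "degree P = card X" using c0 by (subst c) (simp add: deg_prod)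
  \<comment> \<open>Such an \<open>r\<close> is a multiple \<open>P * s\<close> up to a constant,
    and the degree bound says exactly that \<open>degree s < n\<close>.\<close>
  have null: "L r = 0" if "\<And>x. x \<in> X \<Longrightarrow> poly r x = 0" "degree r < n + card X" for r
  proof (cases "r = 0")
    case False
    have "(\<Prod>x\<in>X. [:-x, 1:]) dvd r" using fin that(1) by (rule prod_roots_dvd)
    then obtain s where s: "r = (\<Prod>x\<in>X. [:-x, 1:]) * s" by (rule dvdE)
    have "degree r = card X + degree s"
      using False s by (subst s, subst degree_mult_eq) (auto simp: deg_prod)
    hence "L (P * s) = 0" using that by (intro P(3)) simp
    moreover have "P * s = Polynomial.smult c r" unfolding s by (subst c) simp
    ultimately show ?thesis using c0 by (simp add: smult)
  qed simp
  \<comment> \<open>The Lagrange basis at the nodes.\<close>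
  define l where "l x = Polynomial.smult (1 / (\<Prod>y\<in>X - {x}. x - y)) (\<Prod>y\<in>X - {x}. [:-y, 1:])" for x
  have l_same: "poly (l x) x = 1" for x
    using fin by (simp add: l_def poly_prod)
  have l_other: "poly (l x) y = 0" if "y \<in> X" "x \<noteq> y" for x y
    using fin that by (auto simp: l_def poly_prod)
  have deg_l: "degree (l x) < card X" if "x \<in> X" for x
  proof -
    have "degree (l x) \<le> card (X - {x})"
      unfolding l_def using degree_smult_le deg_prod by metis
    also have "\<dots> < card X" using fin that by (rule card_Diff1_less)
    finally show ?thesis .
  qed
  have "L (l x) \<ge> 0" if "x \<in> X" for x
  proof -
    \<comment> \<open>\<open>l x\<close> takes only the values 0 and 1 on the nodes, so it agrees
      there with its square. The difference has degree below \<open>n + card X\<close> because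
      \<open>card X = degree P \<le> n\<close>. Thus the weight is \<open>L\<close> of a
      square.\<close>
    have "L (l x * l x - l x) = 0"
    proof (rule null)
      show "poly (l x * l x - l x) y = 0" if "y \<in> X" for y
        using that l_same[of x] l_other[of y x] by (cases "x = y") auto
      have "degree (l x * l x) \<le> degree (l x) + degree (l x)" by (rule degree_mult_le)
      thus "degree (l x * l x - l x) < n + card X"
        using deg_l[OF that] P(2) deg by (intro degree_diff_less) auto
    qed
    thus ?thesis using square_nonneg[of "l x"] by (simp add: diff)
  qed
  moreover have "L p = (\<Sum>x\<in>X. L (l x) * poly p x)" if "degree p < n" for p
  proof -
    \<comment> \<open>The difference of \<open>p\<close> and its Lagrange interpolant vanishes at
      all nodes.\<close>
    have "L (p - (\<Sum>x\<in>X. Polynomial.smult (poly p x) (l x))) = 0"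
    proof (rule null)
      show "poly (p - (\<Sum>x\<in>X. Polynomial.smult (poly p x) (l x))) y = 0" if "y \<in> X" for y
      proof -
        have "(\<Sum>x\<in>X. poly p x * poly (l x) y) = (\<Sum>x\<in>X. if x = y then poly p y else 0)"
          using that by (intro sum.cong) (auto simp: l_same l_other)
        thus ?thesis using fin that by (simp add: poly_sum)
      qed
      have "degree (\<Sum>x\<in>X. Polynomial.smult (poly p x) (l x)) < n + card X"
        using that fin
        by (intro degree_sum_less) (auto intro!: le_less_trans[OF degree_smult_le] trans_less_add2 deg_l)
      thus "degree (p - (\<Sum>x\<in>X. Polynomial.smult (poly p x) (l x))) < n + card X"
        using that by (intro degree_diff_less) auto
    qed
    thus ?thesis by (simp add: diff sum smult mult.commute)
  qed
  ultimately show ?thesis using fin by (intro exI[of _ X] exI[of _ "\<lambda>x. L (l x)"]) auto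
qed

end

section \<open>From moments to a functional\<close>

text \<open>On a square \<open>p * p\<close> the functional is the Hankel form of \<open>a\<close>
  evaluated at the coefficients of \<open>p\<close>.\<close>

lemma positive_functional_of_moments:
  fixes a :: "nat \<Rightarrow> real"
  assumes "\<And>n c. (\<Sum>i<n. \<Sum>j<n. c i * c j * a (i + j)) \<ge> 0"
  shows "positive_functional (\<lambda>p. \<Sum>k\<le>degree p. coeff p k * a k)"
proof -
  define L where "L p = (\<Sum>k\<le>degree p. coeff p k * a k)" for p
  \<comment> \<open>Padding with zero coefficients gives polynomials of different degrees a common
    range of summation.\<close>
  have L_eq: "L p = (\<Sum>k\<le>N. coeff p k * a k)" if "degree p \<le> N" for p N
    unfolding L_def using that by (intro sum.mono_neutral_left) (auto simp: coeff_eq_0)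
  have add: "L (p + q) = L p + L q" for p q
    using L_eq[of p "max (degree p) (degree q)"] L_eq[of q "max (degree p) (degree q)"]
      L_eq[OF degree_add_le_max[of p q]] by (simp add: sum.distrib distrib_right)
  have smult: "L (Polynomial.smult c p) = c * L p" for c p
    using L_eq[OF degree_smult_le[of c p]] by (simp add: L_def sum_distrib_left mult.assoc)
  have sum: "L (\<Sum>x\<in>A. f x) = (\<Sum>x\<in>A. L (f x))" for f and A :: "nat set"
    by (induction A rule: infinite_finite_induct) (auto simp: add L_def[of 0])
  have monom: "L (monom c k) = c * a k" for c k
    using L_eq[OF degree_monom_le[of c k]]
    by (simp add: if_distrib[of "\<lambda>x. x * _"] sum.delta' cong: if_cong)
  have "L (p * p) \<ge> 0" for p
  proof -
    have p: "p = (\<Sum>i<Suc (degree p). monom (coeff p i) i)"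
      by (simp add: lessThan_Suc_atMost poly_as_sum_of_monoms)
    have "p * p = (\<Sum>i<Suc (degree p). monom (coeff p i) i) * (\<Sum>j<Suc (degree p). monom (coeff p j) j)"
      by (rule arg_cong2[where f = "(*)", OF p p])
    also have "\<dots> = (\<Sum>i<Suc (degree p). \<Sum>j<Suc (degree p). monom (coeff p i * coeff p j) (i + j))"
      by (simp only: sum_product mult_monom)
    finally have "L (p * p) = (\<Sum>i<Suc (degree p). \<Sum>j<Suc (degree p). coeff p i * coeff p j * a (i + j))"
      by (simp only: sum monom)
    thus ?thesis using assms[where n = "Suc (degree p)" and c = "coeff p"] by (simp only:)
  qed
  thus ?thesis unfolding L_def[symmetric] using add smult by unfold_locales auto
qed

section \<open>Limits of measures with prescribed moments\<close>

lemma ex_finitely_supported_distribution: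
  fixes X :: "real set"
  assumes "finite X" "\<And>x. x \<in> X \<Longrightarrow> w x \<ge> 0" "sum w X = 1"
  shows "\<exists>M. real_distribution M \<and>
    (\<forall>f :: real \<Rightarrow> real. f \<in> borel_measurable borel \<longrightarrow> has_bochner_integral M f (\<Sum>x\<in>X. w x * f x))"
proof -
  define N where "N = point_measure X w"
  \<comment> \<open>\<open>N\<close> lives on the space \<open>X\<close> with all subsets
    measurable; the push-forward along the inclusion turns it into a Borel measure on the
    line.\<close>
  define M where "M = distr N borel (\<lambda>x. x)"
  have meas [measurable]: "(\<lambda>x. x) \<in> N \<rightarrow>\<^sub>M borel"
    by (simp add: N_def measurable_def sets_point_measure space_point_measure Int_absorb1)
  have "prob_space N"
    using assms by (intro prob_spaceI)
      (simp add: N_def space_point_measure emeasure_point_measure_finite)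
  hence "prob_space M" unfolding M_def by (rule prob_space.prob_space_distr) simp
  hence "real_distribution M"
    by (simp add: real_distribution_def real_distribution_axioms_def M_def)
  moreover have "has_bochner_integral M f (\<Sum>x\<in>X. w x * f x)"
    if [measurable]: "f \<in> borel_measurable borel" for f :: "real \<Rightarrow> real"
    using assms
    by (simp add: has_bochner_integral_iff M_def integrable_distr_eq integral_distr N_def[symmetric])
       (simp add: N_def integrable_point_measure_finite lebesgue_integral_point_measure_finite)
  ultimately show ?thesis by blast
qed

text \<open>Chebyshev: the mass outside \<open>{-R<..R}\<close> is at most \<open>c / R^2\<close>,
  uniformly in \<open>n\<close>.\<close>

lemma tight_if_second_moments_eq:
  assumes "\<And>n. real_distribution (\<mu> n)"
    and "\<And>n. has_bochner_integral (\<mu> n) (\<lambda>x. x ^ 2) c"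
  shows "tight \<mu>"
  unfolding tight_def
proof (intro conjI allI impI)
  fix e :: real assume e: "e > 0"
  have c: "c \<ge> 0"
    using assms(2)[of 0] by (auto simp: has_bochner_integral_iff)
  \<comment> \<open>Larger than the square root of \<open>(c + 1) / e\<close>, so that
    \<open>c / R^2 < e\<close>.\<close>
  define R where "R = sqrt ((c + 1) / e) + 1"
  have R: "R > 0" unfolding R_def using c e by (intro add_nonneg_pos) auto
  have "sqrt ((c + 1) / e) ^ 2 < R ^ 2"
    unfolding R_def using c e by (intro power_strict_mono) auto
  hence "(c + 1) / e < R ^ 2" using c e by simp
  hence cR: "c / R ^ 2 < e" using R e c by (simp add: field_simps)
  have "measure (\<mu> n) {-R<..R} > 1 - e" for n
  proof -
    interpret real_distribution "\<mu> n" by (rule assms)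
    have int: "integrable (\<mu> n) (\<lambda>x. x ^ 2)" "(\<integral>x. x ^ 2 \<partial>\<mu> n) = c"
      using assms(2)[of n] by (auto simp: has_bochner_integral_iff)
    have "measure (\<mu> n) (UNIV - {-R<..R}) \<le> measure (\<mu> n) {x \<in> space (\<mu> n). x ^ 2 \<ge> R ^ 2}"
    proof (intro finite_measure_mono subsetI)
      fix x :: real assume "x \<in> UNIV - {-R<..R}"
      hence "\<bar>R\<bar> \<le> \<bar>x\<bar>" using R by auto
      thus "x \<in> {x \<in> space (\<mu> n). x ^ 2 \<ge> R ^ 2}" by (simp add: abs_le_square_iff)
    qed auto
    also have "\<dots> \<le> c / R ^ 2"
      using integral_Markov_inequality_measure[OF int(1), of "{}" "R ^ 2"] int(2) R by simp
    also have "\<dots> < e" by (rule cR)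
    finally show ?thesis
      using prob_compl[of "{-R<..R}"] by simp
  qed
  thus "\<exists>a b. a < b \<and> (\<forall>n. measure (\<mu> n) {a<..b} > 1 - e)"
    using R by (intro exI[of _ "-R"] exI[of _ R]) auto
qed (use assms in auto)

section \<open>Convergence of moments under weak limits\<close>

text \<open>Powers of this truncation are bounded and continuous, hence test functions for weak
  convergence, which \<open>x ^ k\<close> is not for \<open>k > 0\<close>.\<close>

definition clip :: "real \<Rightarrow> real \<Rightarrow> real" where
  "clip R x = max (- R) (min R x)"

lemma continuous_clip: "continuous_on UNIV (clip R)"
  unfolding clip_def by (intro continuous_intros)

lemma abs_clip: "R \<ge> 0 \<Longrightarrow> \<bar>clip R x\<bar> = min R \<bar>x\<bar>"
  by (auto simp: clip_def)

lemma clip_eq: "\<bar>x\<bar> \<le> R \<Longrightarrow> clip R x = x"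
  by (auto simp: clip_def)

text \<open>The error lives where \<open>\<bar>x\<bar> > R\<close>; there both powers are at most
  \<open>\<bar>x\<bar> ^ k\<close>, and a further factor \<open>(\<bar>x\<bar> / R) ^ k\<close>
  exceeds no bound below 1. The moment of order \<open>2 * k\<close> thus controls the
  truncation.\<close>

lemma clip_power_error:
  assumes "R > 0"
  shows "\<bar>clip R x ^ k - x ^ k\<bar> \<le> 2 / R ^ k * x ^ (2 * k)"
proof (cases "\<bar>x\<bar> \<le> R")
  case False
  hence "\<bar>clip R x ^ k - x ^ k\<bar> \<le> \<bar>clip R x\<bar> ^ k + \<bar>x\<bar> ^ k"
    by (metis abs_triangle_ineq4 power_abs)
  also have "\<dots> \<le> 2 * \<bar>x\<bar> ^ k"
    using assms by (simp add: abs_clip power_mono)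
  also have "R ^ k * \<bar>x\<bar> ^ k \<le> \<bar>x\<bar> ^ k * \<bar>x\<bar> ^ k"
    using False assms by (intro mult_right_mono power_mono) auto
  hence "2 * \<bar>x\<bar> ^ k \<le> 2 / R ^ k * x ^ (2 * k)"
    using assms by (simp add: field_simps power_mult power2_eq_square flip: power_abs abs_mult)
  finally show ?thesis by simp
qed (use assms in \<open>simp add: clip_eq power_mult\<close>)

lemma clip_tendsto: "(\<lambda>m. clip (real m) x) \<longlonglongrightarrow> x"
proof (rule tendsto_eventually)
  have "eventually (\<lambda>m. \<bar>x\<bar> \<le> real m) sequentially" by real_asymp
  thus "eventually (\<lambda>m. clip (real m) x = x) sequentially"
    by eventually_elim (rule clip_eq)
qed

text \<open>Truncate, pass to the weak limit, then let the truncation level grow. The moments are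
  assumed only eventually, since each quadrature measure matches finitely many.\<close>

lemma has_integral_power_weak_limit:
  assumes \<mu>: "\<And>n. real_distribution (\<mu> n)" and M: "real_distribution M"
    and conv: "weak_conv_m \<mu> M"
    and moments: "\<And>k. eventually (\<lambda>n. has_bochner_integral (\<mu> n) (\<lambda>x. x ^ k) (a k)) sequentially"
  shows "has_bochner_integral M (\<lambda>x. x ^ k) (a k)"
proof -
  interpret M: real_distribution M by fact
  have clip_meas [measurable]: "clip R \<in> borel_measurable borel" for R
    by (intro borel_measurable_continuous_onI continuous_clip)
  have lim: "(\<lambda>n. \<integral>x. clip R x ^ k \<partial>\<mu> n) \<longlonglongrightarrow> (\<integral>x. clip R x ^ k \<partial>M)" if "R > 0" for R k
  proof (rule weak_conv_imp_integral_bdd_continuous_conv[OF \<mu> M conv, where B = "R ^ k"])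
    show "isCont (\<lambda>x. clip R x ^ k) x" for x
      using continuous_clip[of R] by (intro continuous_intros) (simp add: continuous_on_eq_continuous_at)
    show "norm (clip R x ^ k) \<le> R ^ k" for x
      using that by (auto simp: norm_power power_abs abs_clip intro!: power_mono)
  qed
  have int_clip: "integrable N (\<lambda>x. clip R x ^ k)" if "real_distribution N" "R > 0" for N R k
  proof -
    interpret N: real_distribution N by fact
    show ?thesis
      using that by (intro N.integrable_const_bound[where B = "R ^ k"])
        (auto simp: norm_power power_abs abs_clip intro!: power_mono)
  qed
  have even_nonneg: "0 \<le> x ^ (2 * k)" for x :: real and k by simp
  have a_even: "a (2 * k) \<ge> 0" for k
  proof -
    obtain n where "has_bochner_integral (\<mu> n) (\<lambda>x. x ^ (2 * k)) (a (2 * k))"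
      using eventually_happens[OF moments[of "2 * k"]] by auto
    hence "a (2 * k) = (\<integral>x. x ^ (2 * k) \<partial>\<mu> n)" by (simp add: has_bochner_integral_iff)
    also have "\<dots> \<ge> 0" by simp
    finally show ?thesis .
  qed
  \<comment> \<open>The truncation error is bounded independently of \<open>n\<close>, so the bound
    survives in the limit measure.\<close>
  have bound: "\<bar>(\<integral>x. clip R x ^ k \<partial>M) - a k\<bar> \<le> 2 / R ^ k * a (2 * k)" if "R > 0" for R k
  proof (rule tendsto_upperbound)
    show "(\<lambda>n. \<bar>(\<integral>x. clip R x ^ k \<partial>\<mu> n) - a k\<bar>) \<longlonglongrightarrow> \<bar>(\<integral>x. clip R x ^ k \<partial>M) - a k\<bar>"
      by (intro tendsto_intros lim that)
    show "eventually (\<lambda>n. \<bar>(\<integral>x. clip R x ^ k \<partial>\<mu> n) - a k\<bar> \<le> 2 / R ^ k * a (2 * k)) sequentially"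
      using moments[of k] moments[of "2 * k"]
    proof eventually_elim
      case (elim n)
      note i = int_clip[OF \<mu>[of n] that, of k]
      have "\<bar>(\<integral>x. clip R x ^ k \<partial>\<mu> n) - a k\<bar> = \<bar>\<integral>x. clip R x ^ k - x ^ k \<partial>\<mu> n\<bar>"
        using elim i by (simp add: has_bochner_integral_iff)
      also have "\<dots> \<le> (\<integral>x. 2 / R ^ k * x ^ (2 * k) \<partial>\<mu> n)"
        using elim i clip_power_error[OF that]
        by (intro integral_abs_bound_integral) (auto simp: has_bochner_integral_iff)
      also have "\<dots> = 2 / R ^ k * a (2 * k)"
        using elim by (simp add: has_bochner_integral_iff)
      finally show ?case .
    qed
  qed simp
  \<comment> \<open>Fatou's lemma along growing truncations. The level \<open>Suc m\<close> is at
    least 1, so \<open>2 / real (Suc m) ^ (2 * k)\<close> is at most 2.\<close>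
  have even_int: "integrable M (\<lambda>x. x ^ (2 * k))" for k
  proof (rule integrableI_bounded)
    have "(\<integral>\<^sup>+x. ennreal (norm (x ^ (2 * k))) \<partial>M)
        = (\<integral>\<^sup>+x. liminf (\<lambda>m. ennreal (clip (real (Suc m)) x ^ (2 * k))) \<partial>M)"
    proof (intro nn_integral_cong)
      fix x
      have "(\<lambda>m. ennreal (clip (real (Suc m)) x ^ (2 * k))) \<longlonglongrightarrow> ennreal (x ^ (2 * k))"
        by (intro tendsto_intros LIMSEQ_Suc[OF clip_tendsto])
      from lim_imp_Liminf[OF _ this]
      show "ennreal (norm (x ^ (2 * k))) = liminf (\<lambda>m. ennreal (clip (real (Suc m)) x ^ (2 * k)))"
        by (simp add: even_nonneg)
    qed
    also have "\<dots> \<le> liminf (\<lambda>m. \<integral>\<^sup>+x. ennreal (clip (real (Suc m)) x ^ (2 * k)) \<partial>M)"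
      by (intro nn_integral_liminf) measurable
    also have "\<dots> \<le> liminf (\<lambda>m. ennreal (a (2 * k) + 2 * a (2 * (2 * k))))"
    proof (intro Liminf_mono always_eventually allI)
      fix m
      have R: "real (Suc m) > 0" by simp
      have "(\<integral>x. clip (real (Suc m)) x ^ (2 * k) \<partial>M)
          \<le> a (2 * k) + 2 / real (Suc m) ^ (2 * k) * a (2 * (2 * k))"
        using bound[OF R, of "2 * k"] by linarith
      also have "2 / real (Suc m) ^ (2 * k) * a (2 * (2 * k)) \<le> 2 * a (2 * (2 * k))"
        using a_even[of "2 * k"] by (intro mult_right_mono) (auto simp: divide_le_eq)
      finally show "(\<integral>\<^sup>+x. ennreal (clip (real (Suc m)) x ^ (2 * k)) \<partial>M)
          \<le> ennreal (a (2 * k) + 2 * a (2 * (2 * k)))"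
        using int_clip[OF M R, of "2 * k"]
        by (subst nn_integral_eq_integral) (auto intro!: ennreal_leI simp: zero_le_even_power)
    qed
    also have "\<dots> < \<infinity>" by (simp add: Liminf_const)
    finally show "(\<integral>\<^sup>+x. ennreal (norm (x ^ (2 * k))) \<partial>M) < \<infinity>" .
  qed simp
  have int: "integrable M (\<lambda>x. x ^ k)"
  proof (rule Bochner_Integration.integrable_bound)
    show "integrable M (\<lambda>x. 1 + x ^ (2 * k))" using even_int by simp
    have "\<bar>x ^ k\<bar> \<le> 1 + x ^ (2 * k)" for x :: real
      using sum_squares_bound[of "\<bar>x ^ k\<bar>" 1] by (simp add: power_even_eq)
    thus "AE x in M. norm (x ^ k) \<le> norm (1 + x ^ (2 * k))"
      by (intro AE_I2) (simp add: order.trans[OF _ abs_ge_self])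
  qed simp
  have "(\<lambda>m. (\<integral>x. clip (real m) x ^ k \<partial>M)) \<longlonglongrightarrow> (\<integral>x. x ^ k \<partial>M)"
  proof (rule integral_dominated_convergence)
    show "integrable M (\<lambda>x. \<bar>x ^ k\<bar>)" using int by simp
    show "AE x in M. (\<lambda>m. clip (real m) x ^ k) \<longlonglongrightarrow> x ^ k"
      by (intro AE_I2 tendsto_intros clip_tendsto)
    show "AE x in M. norm (clip (real m) x ^ k) \<le> \<bar>x ^ k\<bar>" for m
      by (intro AE_I2) (simp add: norm_power power_abs abs_clip power_mono)
  qed simp_all
  moreover have "(\<lambda>m. (\<integral>x. clip (real m) x ^ k \<partial>M)) \<longlonglongrightarrow> a k"
  \<comment> \<open>For \<open>k = 0\<close> the bound \<open>2 / R ^ k * a (2 * k)\<close> does not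
    tend to 0; there both sides are the total mass 1.\<close>
  proof (cases "k = 0")
    case True
    obtain n where n: "has_bochner_integral (\<mu> n) (\<lambda>x. x ^ 0) (a 0)"
      using eventually_happens[OF moments[of 0]] by auto
    interpret \<mu>n: real_distribution "\<mu> n" by fact
    have "a 0 = 1"
      using n \<mu>n.prob_space by (simp add: has_bochner_integral_iff)
    thus ?thesis using True M.prob_space by simp
  next
    case False
    have "(\<lambda>m. (\<integral>x. clip (real m) x ^ k \<partial>M) - a k) \<longlonglongrightarrow> 0"
    proof (rule Lim_null_comparison)
      show "eventually (\<lambda>m. norm ((\<integral>x. clip (real m) x ^ k \<partial>M) - a k)
          \<le> 2 / real m ^ k * a (2 * k)) sequentially"
        using eventually_gt_at_top[of 0] by eventually_elim (use bound in auto)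
      have "filterlim (\<lambda>m. real m ^ k) at_top sequentially"
        using False by (intro filterlim_pow_at_top filterlim_real_sequentially) auto
      from tendsto_mult_left_zero[OF tendsto_divide_0[OF tendsto_const filterlim_at_top_imp_at_infinity[OF this]]]
      show "(\<lambda>m. 2 / real m ^ k * a (2 * k)) \<longlonglongrightarrow> 0" .
    qed
    thus ?thesis by (rule LIM_zero_cancel)
  qed
  ultimately have "(\<integral>x. x ^ k \<partial>M) = a k" by (rule LIMSEQ_unique)
  thus ?thesis using int by (simp add: has_bochner_integral_iff)
qed

section \<open>Hamburger's theorem for positive semidefinite sequences\<close>

theorem hamburger_if_positive_semidefinite:
  fixes a :: "nat \<Rightarrow> real"
  assumes pos: "\<And>n c. (\<Sum>i<n. \<Sum>j<n. c i * c j * a (i + j)) \<ge> 0"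
    and a0: "a 0 = 1"
  shows "\<exists>\<mu>. real_distribution \<mu> \<and> (\<forall>n. has_bochner_integral \<mu> (\<lambda>x. x ^ n) (a n))"
proof -
  define L where "L p = (\<Sum>k\<le>degree p. coeff p k * a k)" for p
  interpret positive_functional L
    using positive_functional_of_moments[of a] pos unfolding L_def by blast
  have L_monom: "L (monom 1 k) = a k" for k
    by (simp add: L_def degree_monom_eq if_distrib[of "\<lambda>x. x * _"] sum.delta' cong: if_cong)
  have "\<exists>\<mu>. real_distribution \<mu> \<and> (\<forall>k<n. has_bochner_integral \<mu> (\<lambda>x. x ^ k) (a k))" if "n > 0" for n
  proof -
    obtain X w where X: "finite X" "\<And>x. x \<in> X \<Longrightarrow> w x \<ge> 0"
        and L: "\<And>p. degree p < n \<Longrightarrow> L p = (\<Sum>x\<in>X. w x * poly p x)"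
      using quadrature[of n] by blast
    have a_eq: "a k = (\<Sum>x\<in>X. w x * x ^ k)" if "k < n" for k
      using L[of "monom 1 k"] that by (simp add: L_monom degree_monom_eq poly_monom)
    \<comment> \<open>The moment of order 0 is the total mass, so \<open>a0\<close> makes the
      quadrature a probability distribution.\<close>
    have "sum w X = 1" using a_eq[of 0] that a0 by simp
    from ex_finitely_supported_distribution[OF X this] obtain M where M: "real_distribution M \<and>
        (\<forall>f :: real \<Rightarrow> real. f \<in> borel_measurable borel \<longrightarrow>
            has_bochner_integral M f (\<Sum>x\<in>X. w x * f x))"
      by (rule exE)
    have "has_bochner_integral M (\<lambda>x. x ^ k) (a k)" if "k < n" for k
      unfolding a_eq[OF that] using M by simp
    with M show ?thesis by (intro exI[of _ M]) simp
  qed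
  \<comment> \<open>The shift by 3 makes every measure of the sequence, already the one at 0, have
    the second moment \<open>a 2\<close> used for tightness.\<close>
  hence "\<forall>n. \<exists>\<mu>. real_distribution \<mu> \<and> (\<forall>k<n + 3. has_bochner_integral \<mu> (\<lambda>x. x ^ k) (a k))"
    by simp
  then obtain \<mu> where \<mu>: "\<And>n. real_distribution (\<mu> n)"
      "\<And>n k. k < n + 3 \<Longrightarrow> has_bochner_integral (\<mu> n) (\<lambda>x. x ^ k) (a k)"
    by metis
  have "tight \<mu>" by (rule tight_if_second_moments_eq[where c = "a 2"]) (use \<mu> in auto)
  from tight_imp_convergent_subsubsequence[OF this strict_mono_id]
  obtain r M where r: "strict_mono r" and M: "real_distribution M" and conv: "weak_conv_m (\<mu> \<circ> id \<circ> r) M"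
    by blast
  have "has_bochner_integral M (\<lambda>x. x ^ k) (a k)" for k
  proof (rule has_integral_power_weak_limit[OF _ M conv])
    show "eventually (\<lambda>n. has_bochner_integral ((\<mu> \<circ> id \<circ> r) n) (\<lambda>x. x ^ k) (a k)) sequentially" for k
      using eventually_ge_at_top[of k]
    proof eventually_elim
      case (elim n)
      hence "k < r n + 3" using seq_suble[OF r, of n] by linarith
      thus ?case using \<mu>(2) by simp
    qed
  qed (simp add: \<mu>)
  with M show ?thesis by blast
qed

section \<open>Counting walks\<close>

definition walks :: "'v set \<Rightarrow> 'e set \<Rightarrow> ('e \<Rightarrow> 'v set) \<Rightarrow> nat \<Rightarrow> 'v \<Rightarrow> 'v \<Rightarrow> ('v list \<times> 'e list) set" where
  "walks V E ends n u v =
     {(vs, es). length vs = Suc n \<and> length es = n \<and> set vs \<subseteq> V \<and> set es \<subseteq> E \<and>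
        vs ! 0 = u \<and> vs ! n = v \<and> (\<forall>i<n. ends (es ! i) = {vs ! i, vs ! Suc i})}"

text \<open>Undirectedness enters here: \<open>ends\<close> yields unordered pairs, so every edge
  can be traversed backwards.\<close>

lemma walks_rev:
  assumes "(vs, es) \<in> walks V E ends n u v"
  shows "(rev vs, rev es) \<in> walks V E ends n v u"
proof -
  have "ends (rev es ! i) = {rev vs ! i, rev vs ! Suc i}" if "i < n" for i
  proof -
    have "Suc (n - Suc i) = n - i" using that by simp
    thus ?thesis using assms that by (auto simp: walks_def rev_nth)
  qed
  thus ?thesis using assms by (auto simp: walks_def rev_nth)
qed

text \<open>\<open>tl\<close> drops the junction \<open>v\<close>, which is already the last vertex
  of the first walk.\<close>

lemma walks_append:
  assumes "(vs, es) \<in> walks V E ends m u v" "(vs', es') \<in> walks V E ends n v w"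
  shows "(vs @ tl vs', es @ es') \<in> walks V E ends (m + n) u w"
proof -
  have len: "length vs = Suc m" "length es = m" "length vs' = Suc n" "length es' = n"
    using assms by (auto simp: walks_def)
  have left: "(vs @ tl vs') ! i = vs ! i" if "i \<le> m" for i
    using that len by (simp add: nth_append)
  have right: "(vs @ tl vs') ! (m + i) = vs' ! i" if "i \<le> n" for i
    using that len assms by (cases i) (auto simp: nth_append nth_tl walks_def)
  have "ends ((es @ es') ! i) = {(vs @ tl vs') ! i, (vs @ tl vs') ! Suc i}" if "i < m + n" for i
  proof (cases "i < m")
    case True
    thus ?thesis using assms len left[of i] left[of "Suc i"] by (simp add: nth_append walks_def)
  next
    case False
    then obtain j where j: "i = m + j" using le_Suc_ex by (auto simp: not_less)
    thus ?thesis using assms len that right[of j] right[of "Suc j"]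
      by (simp add: nth_append walks_def)
  qed
  moreover have "set (tl vs') \<subseteq> set vs'" using list.set_sel(2)[of vs'] len by (cases vs') auto
  ultimately show ?thesis
    using assms len left[of 0] right[of n] by (auto simp: walks_def)
qed

lemma walks_take:
  assumes "(vs, es) \<in> walks V E ends (m + n) u w"
  shows "(take (Suc m) vs, take m es) \<in> walks V E ends m u (vs ! m)"
  using assms by (auto simp: walks_def dest: in_set_takeD)

lemma walks_drop:
  assumes "(vs, es) \<in> walks V E ends (m + n) u w"
  shows "(drop m vs, drop m es) \<in> walks V E ends n (vs ! m) w"
  using assms by (auto simp: walks_def dest: in_set_dropD)

lemma card_walks_rev: "card (walks V E ends n u v) = card (walks V E ends n v u)"
  by (rule bij_betw_same_card[of "\<lambda>(vs, es). (rev vs, rev es)"],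
      rule bij_betwI[where g = "\<lambda>(vs, es). (rev vs, rev es)"])
     (auto intro: walks_rev)

text \<open>Cutting after \<open>m\<close> steps is a bijection onto pairs of walks meeting at the
  cut vertex. \<open>S\<close> is a finite set containing every vertex where the cut can
  occur.\<close>

lemma card_walks_add:
  assumes fin: "finite S" "\<And>v. finite (walks V E ends m u v)" "\<And>v. finite (walks V E ends n v w)"
    and S: "\<And>v. v \<notin> S \<Longrightarrow> walks V E ends m u v = {}"
  shows "card (walks V E ends (m + n) u w)
       = (\<Sum>v\<in>S. card (walks V E ends m u v) * card (walks V E ends n v w))"
proof -
  let ?f = "\<lambda>(vs, es). (vs ! m, (take (Suc m) vs, take m es), (drop m vs, drop m es))"
  let ?g = "\<lambda>(v, (vs, es), (vs', es')). (vs @ tl vs', es @ es')"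
  let ?T = "SIGMA v:S. walks V E ends m u v \<times> walks V E ends n v w"
  have "bij_betw ?f (walks V E ends (m + n) u w) ?T"
  proof (rule bij_betwI[where g = ?g])
    show "?f \<in> walks V E ends (m + n) u w \<rightarrow> ?T"
      using walks_take walks_drop S by fastforce
    show "?g \<in> ?T \<rightarrow> walks V E ends (m + n) u w"
      using walks_append by fastforce
    show "?g (?f x) = x" if "x \<in> walks V E ends (m + n) u w" for x
      using that by (auto simp: walks_def tl_drop simp flip: drop_Suc)
    show "?f (?g y) = y" if "y \<in> ?T" for y
    proof -
      obtain v p p' where "y = (v, p, p')" by (rule prod_cases3)
      moreover obtain vs es where "p = (vs, es)" by (rule prod.exhaust)
      moreover obtain vs' es' where "p' = (vs', es')" by (rule prod.exhaust)
      ultimately have y: "y = (v, (vs, es), (vs', es'))" by simp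
      have mem: "(vs, es) \<in> walks V E ends m u v" "(vs', es') \<in> walks V E ends n v w"
        using that y by auto
      hence len: "length vs = Suc m" "length es = m" "vs ! m = v" "vs' \<noteq> []" "vs' ! 0 = v"
        by (auto simp: walks_def)
      \<comment> \<open>The junction is the last entry of \<open>vs\<close>, so cutting the glued
        list at \<open>m\<close> returns it as the head of the second piece.\<close>
      have "drop m vs = [v]"
        using len by (simp add: Cons_nth_drop_Suc[symmetric])
      thus ?thesis using len by (cases vs') (auto simp: y nth_append)
    qed
  qed
  hence "card (walks V E ends (m + n) u w) = card ?T" by (rule bij_betw_same_card)
  also have "\<dots> = (\<Sum>v\<in>S. card (walks V E ends m u v) * card (walks V E ends n v w))"
    using fin by (simp add: card_cartesian_product)
  finally show ?thesis .
qed

text \<open>By induction on the length: a walk is extended by one of the finitely many edges at its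
  last vertex and an end of that edge. The union over all endpoints also yields that only finitely
  many vertices are reached.\<close>

lemma (in locally_finite_graph) finite_walks_from:
  assumes "u \<in> V"
  shows "finite (\<Union>v. walks V E ends n u v)"
proof (induction n)
  case 0
  have "(\<Union>v. walks V E ends 0 u v) \<subseteq> {([u], [])}"
    by (auto simp: walks_def length_Suc_conv)
  thus ?case by (rule finite_subset) simp
next
  case (Suc n)
  let ?W = "\<Union>v. walks V E ends n u v"
  let ?I = "\<lambda>x. {e \<in> E. x \<in> ends e}"
  have fin_ends: "finite (ends e)" if "e \<in> E" for e using ends_vertices[OF that] by auto
  have "(\<Union>v. walks V E ends (Suc n) u v) \<subseteq>
      (\<Union>(vs, es)\<in>?W. \<Union>e\<in>?I (last vs). \<Union>x\<in>ends e. {(vs @ [x], es @ [e])})"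
  proof
    fix p assume "p \<in> (\<Union>v. walks V E ends (Suc n) u v)"
    then obtain vs es v where p: "p = (vs, es)" "(vs, es) \<in> walks V E ends (Suc n) u v"
      by (cases p) auto
    have w: "(take (Suc n) vs, take n es) \<in> walks V E ends n u (vs ! n)"
      using walks_take[of vs es V E ends n 1] p(2) by simp
    have e: "es ! n \<in> E" "ends (es ! n) = {vs ! n, vs ! Suc n}"
      and vs: "vs = take (Suc n) vs @ [vs ! Suc n]" and es: "es = take n es @ [es ! n]"
      using p(2) by (auto simp: walks_def simp flip: take_Suc_conv_app_nth)
    have "last (take (Suc n) vs) = vs ! n"
      using p(2) by (simp add: walks_def take_Suc_conv_app_nth)
    hence "p \<in> (\<Union>e\<in>?I (last (take (Suc n) vs)). \<Union>x\<in>ends e. {(take (Suc n) vs @ [x], take n es @ [e])})"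
      using e vs es p(1) by auto
    with w show "p \<in> (\<Union>(vs, es)\<in>?W. \<Union>e\<in>?I (last vs). \<Union>x\<in>ends e. {(vs @ [x], es @ [e])})"
      by blast
  qed
  moreover have "finite (\<Union>(vs, es)\<in>?W. \<Union>e\<in>?I (last vs). \<Union>x\<in>ends e. {(vs @ [x], es @ [e])})"
  proof -
    have "finite (?I (last vs))" if "(vs, es) \<in> ?W" for vs es
    proof (rule finite_degree)
      have "vs \<noteq> []" "set vs \<subseteq> V" using that by (auto simp: walks_def)
      thus "last vs \<in> V" by auto
    qed
    hence "finite (\<Union>e\<in>?I (last vs). \<Union>x\<in>ends e. {(vs @ [x], es @ [e])})"
      if "(vs, es) \<in> ?W" for vs es
      using that fin_ends by (intro finite_UN_I) auto
    thus ?thesis by (intro finite_UN_I[OF Suc.IH]) (simp only: split_paired_all prod.case)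
  qed
  ultimately show ?case by (rule finite_subset)
qed

section \<open>Closed walk counts as moments\<close>

theorem theorem4p3:
  fixes V :: "'v set" and E :: "'e set" and ends :: "'e \<Rightarrow> 'v set" and v0 :: 'v
    and t :: "nat \<Rightarrow> nat"
  assumes "locally_finite_graph V E ends"
    and "v0 \<in> V"
    and "\<And>n. t n = card (closed_walks V E ends v0 n)"
  shows "(\<exists>\<mu> :: real measure. real_distribution \<mu> \<and>
            (\<forall>n. has_bochner_integral \<mu> (\<lambda>x. x ^ n) (real (t n))))
         \<and> hamburger_moment_sequence (\<lambda>n. real (t n))"
proof -
  interpret locally_finite_graph V E ends by fact
  have t: "t n = card (walks V E ends n v0 v0)" for n
    by (simp add: assms(3) closed_walks_def walks_def)
  have fin: "finite (walks V E ends n v0 v)" for n v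
    by (rule finite_subset[OF _ finite_walks_from[OF assms(2), of n]]) auto
  have fin': "finite (walks V E ends n v v0)" for n v
  proof (rule finite_subset)
    show "walks V E ends n v v0 \<subseteq> (\<lambda>(vs, es). (rev vs, rev es)) ` walks V E ends n v0 v"
    proof (rule subrelI)
      fix vs es assume "(vs, es) \<in> walks V E ends n v v0"
      from imageI[OF walks_rev[OF this], of "\<lambda>(vs, es). (rev vs, rev es)"]
      show "(vs, es) \<in> (\<lambda>(vs, es). (rev vs, rev es)) ` walks V E ends n v0 v" by simp
    qed
  qed (use fin in simp)
  have "0 \<le> (\<Sum>i<n. \<Sum>j<n. c i * c j * real (t (i + j)))" for n c
  proof -
    \<comment> \<open>The vertices reachable from \<open>v0\<close> in fewer than \<open>n\<close>
      steps.\<close>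
    define S where "S = (\<Union>i<n. (\<lambda>(vs, es). last vs) ` (\<Union>v. walks V E ends i v0 v))"
    define W where "W i v = real (card (walks V E ends i v0 v))" for i v
    have "finite S" unfolding S_def using finite_walks_from[OF assms(2)] by blast
    have S: "walks V E ends i v0 v = {}" if "i < n" "v \<notin> S" for i v
    proof (rule ccontr)
      assume "walks V E ends i v0 v \<noteq> {}"
      then obtain vs es where w: "(vs, es) \<in> walks V E ends i v0 v" by auto
      hence "last vs = v"
        by (auto simp: walks_def last_conv_nth simp flip: length_greater_0_conv)
      with w that show False unfolding S_def by force
    qed
    \<comment> \<open>Cut after \<open>i\<close> steps, at a vertex of \<open>S\<close>, and reverse
      the second piece. This exhibits the Hankel matrix of \<open>t\<close> as a Gram
      matrix.\<close>
    have "real (t (i + j)) = (\<Sum>v\<in>S. W i v * W j v)" if "i < n" for i j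
      using card_walks_add[OF \<open>finite S\<close> fin fin' S[OF that], of j]
      by (simp add: t W_def card_walks_rev[of V E ends j _ v0])
    hence "(\<Sum>i<n. \<Sum>j<n. c i * c j * real (t (i + j)))
        = (\<Sum>i<n. \<Sum>j<n. \<Sum>v\<in>S. (c i * W i v) * (c j * W j v))"
      by (intro sum.cong refl) (simp add: sum_distrib_left mult_ac)
    also have "\<dots> = (\<Sum>v\<in>S. \<Sum>i<n. \<Sum>j<n. (c i * W i v) * (c j * W j v))"
      by (simp only: sum.swap[of _ S])
    also have "\<dots> = (\<Sum>v\<in>S. (\<Sum>i<n. c i * W i v) ^ 2)"
      by (simp add: power2_eq_square sum_product)
    also have "\<dots> \<ge> 0" by (intro sum_nonneg) simp
    finally show ?thesis .
  qed
  moreover have "walks V E ends 0 v0 v0 = {([v0], [])}"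
    using assms(2) by (auto simp: walks_def length_Suc_conv)
  hence "real (t 0) = 1" by (simp add: t)
  ultimately have ex: "\<exists>\<mu>. real_distribution \<mu> \<and> (\<forall>n. has_bochner_integral \<mu> (\<lambda>x. x ^ n) (real (t n)))"
    by (rule hamburger_if_positive_semidefinite)
  moreover have "sets \<mu> = sets borel" if "real_distribution \<mu>" for \<mu> :: "real measure"
    using that by (simp add: real_distribution.events_eq_borel)
  ultimately show ?thesis unfolding hamburger_moment_sequence_def by blast
qed

end
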